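(* Let $(X,\|\cdot\|)$ be a normed linear space over $\mathbb{C}$, let $n\ge 1$ be an integer and $\overline{\mathbf{x}}=(x_1,\dots,x_n)\in X^n$. Suppose there are $x\in X$ and $R>0$ such that $\|x_k-x\|\le R$ for every $k\in\{1,\dots,n\}$. Then $$\left\|\mathcal{F}_\omega(\overline{\mathbf{x}})(m)-\frac{\sin(\omega mn)}{\sin(\omega m)}\exp\left[\omega(n+1)im\right]\cdot\frac1n\sum_{k=1}^n x_k\right\|\le R\sum_{k=1}^n\left|\exp(2\omega imk)-\frac1n\cdot\frac{\sin(\omega mn)}{\sin(\omega m)}\exp\left[\omega(n+1)im\right]\right|$$ for all $m\in\{1,\dots,n\}$ and all $\omega\in\mathbb{R}$ with $\omega\ne\frac{\ell}{m}\pi$ for every $\ell\in\mathbb{Z}$.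
   Context: Here $i^2=-1$. For $\omega\in\mathbb{R}$ and a sequence $\overline{\mathbf{x}}=(x_1,\dots,x_n)$ of vectors in a complex normed space $X$, the discrete Fourier transform is $$\mathcal{F}_\omega(\overline{\mathbf{x}})(m):=\sum_{k=1}^n\exp(2\omega imk)\,x_k,\qquad m=1,\dots,n.$$ *)

theory Defs
  imports "HOL-Analysis.Analysis"
begin

text \<open>Normed linear spaces over the complex numbers. The real scalar multiplication inherited from
  \<^class>\<open>real_normed_vector\<close> is the restriction of the complex one, so the class adds no structure
  to a complex normed space beyond its complex scalars and its norm.\<close>

class complex_normed_vector = real_normed_vector +
  fixes scaleC :: "complex \<Rightarrow> 'a \<Rightarrow> 'a"  (infixr \<open>*\<^sub>C\<close> 75)
  assumes scaleC_add_right: "a *\<^sub>C (x + y) = a *\<^sub>C x + a *\<^sub>C y"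
    and scaleC_add_left: "(a + b) *\<^sub>C x = a *\<^sub>C x + b *\<^sub>C x"
    and scaleC_scaleC: "a *\<^sub>C (b *\<^sub>C x) = (a * b) *\<^sub>C x"
    and scaleC_one: "1 *\<^sub>C x = x"
    and scaleR_scaleC: "r *\<^sub>R x = complex_of_real r *\<^sub>C x"
    and norm_scaleC: "norm (a *\<^sub>C x) = cmod a * norm x"

instantiation complex :: complex_normed_vector
begin

definition scaleC_complex :: "complex \<Rightarrow> complex \<Rightarrow> complex"
  where "scaleC_complex a z = a * z"

instance
  by standard (simp_all add: scaleC_complex_def algebra_simps norm_mult scaleR_conv_of_real)

end

text \<open>A finite sequence of length \<open>n\<close> is the restriction of \<open>x :: nat \<Rightarrow> 'a\<close> to \<open>{1..n}\<close>.\<close>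

definition dft :: "real \<Rightarrow> nat \<Rightarrow> (nat \<Rightarrow> 'a::complex_normed_vector) \<Rightarrow> nat \<Rightarrow> 'a"
  where "dft \<omega> n x m = (\<Sum>k=1..n. exp (2 * complex_of_real \<omega> * \<i> * of_nat m * of_nat k) *\<^sub>C x k)"

end

theory Submission
  imports Defs
begin

text \<open>The coefficient of the mean of the \<open>x k\<close> is the geometric sum \<open>A\<close> of the weights
  \<open>a k = exp (2 * \<omega> * \<i> * m * k)\<close>. The reduced weights \<open>a k - A / n\<close> therefore sum to zero, so
  the \<open>x k\<close> may be replaced by \<open>x k - c\<close>, and the triangle inequality applies.\<close>

lemma scaleC_zero_left: "0 *\<^sub>C x = (0::'a::complex_normed_vector)"
  using scaleC_add_left[of 0 0 x] by simp

lemma scaleC_diff_right: "a *\<^sub>C (x - y) = a *\<^sub>C x - a *\<^sub>C (y::'a::complex_normed_vector)"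
  using scaleC_add_right[of a "x - y" y] by (simp add: algebra_simps)

lemma scaleC_diff_left: "(a - b) *\<^sub>C x = a *\<^sub>C x - b *\<^sub>C (x::'a::complex_normed_vector)"
  using scaleC_add_left[of "a - b" b x] by (simp add: algebra_simps)

lemma scaleC_sum_left: "(\<Sum>k\<in>K. a k) *\<^sub>C x = (\<Sum>k\<in>K. a k *\<^sub>C (x::'a::complex_normed_vector))"
  by (induction K rule: infinite_finite_induct) (simp_all add: scaleC_zero_left scaleC_add_left)

lemma scaleC_sum_right: "a *\<^sub>C (\<Sum>k\<in>K. x k) = (\<Sum>k\<in>K. a *\<^sub>C (x k::'a::complex_normed_vector))"
proof -
  have "a *\<^sub>C (0::'a) = 0"
    using scaleC_add_right[of a 0 0] by simp
  then show ?thesis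
    by (induction K rule: infinite_finite_induct) (simp_all add: scaleC_add_right)
qed

text \<open>The weights are arbitrary: the Fourier exponentials matter only through their sum
  \<open>A\<close>, so the analytic part separates from the trigonometric one.\<close>

lemma norm_weighted_sum_diff_mean_le:
  fixes x :: "'b \<Rightarrow> 'a::complex_normed_vector" and a :: "'b \<Rightarrow> complex"
  assumes "finite K" "K \<noteq> {}" and bound: "\<And>k. k \<in> K \<Longrightarrow> norm (x k - c) \<le> R"
  defines "A \<equiv> (\<Sum>k\<in>K. a k)"
  shows "norm ((\<Sum>k\<in>K. a k *\<^sub>C x k) - A *\<^sub>C ((1 / of_nat (card K)) *\<^sub>C (\<Sum>k\<in>K. x k)))
    \<le> R * (\<Sum>k\<in>K. cmod (a k - 1 / of_nat (card K) * A))"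
proof -
  define b where "b k = a k - 1 / of_nat (card K) * A" for k
  \<comment> \<open>Subtracting \<open>A / card K\<close> from each of the \<open>card K\<close>
    weights removes \<open>A\<close> in total; finiteness and nonemptiness of \<open>K\<close> make
    \<open>card K\<close> invertible.\<close>
  have "(\<Sum>k\<in>K. b k) = 0"
    using assms(1,2) by (simp add: b_def sum_subtractf A_def)
  then have b0: "(\<Sum>k\<in>K. b k *\<^sub>C c) = 0"
    by (simp add: scaleC_sum_left[symmetric] scaleC_zero_left)
  have "(\<Sum>k\<in>K. a k *\<^sub>C x k) - A *\<^sub>C ((1 / of_nat (card K)) *\<^sub>C (\<Sum>k\<in>K. x k))
      = (\<Sum>k\<in>K. b k *\<^sub>C x k)"
    by (simp add: b_def scaleC_diff_left sum_subtractf scaleC_scaleC scaleC_sum_right mult.commute)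
  also have "\<dots> = (\<Sum>k\<in>K. b k *\<^sub>C (x k - c))"
    by (simp add: scaleC_diff_right sum_subtractf b0)
  also have "norm \<dots> \<le> (\<Sum>k\<in>K. cmod (b k) * R)"
    by (rule sum_norm_le) (simp add: norm_scaleC bound mult_left_mono)
  finally show ?thesis
    by (simp add: b_def sum_distrib_left mult.commute)
qed

text \<open>The sum telescopes, since
  \<open>2 * \<i> * sin \<theta> * cis (2 * \<theta> * k)\<close> is the difference of
  \<open>cis ((2 * k + 1) * \<theta>)\<close> and \<open>cis ((2 * k - 1) * \<theta>)\<close>.
  Keeping \<open>sin \<theta>\<close> as a factor, not a denominator, spares the induction any side
  condition.\<close>

lemma sin_mult_sum_cis:
  "complex_of_real (sin \<theta>) * (\<Sum>k=1..n. cis (2 * \<theta> * of_nat k))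
    = complex_of_real (sin (\<theta> * of_nat n)) * cis (\<theta> * (of_nat n + 1))"
proof (induction n)
  case 0
  then show ?case by simp
next
  case (Suc n)
  \<comment> \<open>This is the phase of the closed form for \<open>n\<close>. In terms of it
    \<open>\<theta> * n\<close> is \<open>u - \<theta>\<close>, the new summand is
    \<open>cis (u + u)\<close>, and the phase for \<open>Suc n\<close> is
    \<open>\<theta> + u\<close>.\<close>
  define u where "u = \<theta> * (of_nat n + 1)"
  \<comment> \<open>The real part is the subtraction formula for sine; both imaginary parts are
    \<open>sin \<theta> * sin u\<close>.\<close>
  have step: "complex_of_real (sin (u - \<theta>)) + complex_of_real (sin \<theta>) * cis u
      = complex_of_real (sin u) * cis \<theta>"
    by (simp add: complex_eq_iff sin_diff)
  have "complex_of_real (sin \<theta>) * (\<Sum>k=1..Suc n. cis (2 * \<theta> * of_nat k))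
      = complex_of_real (sin (u - \<theta>)) * cis u + complex_of_real (sin \<theta>) * cis (u + u)"
    using Suc.IH by (simp add: u_def algebra_simps)
  also have "\<dots> = (complex_of_real (sin (u - \<theta>)) + complex_of_real (sin \<theta>) * cis u) * cis u"
    by (simp only: cis_mult distrib_right mult.assoc)
  also have "\<dots> = complex_of_real (sin u) * cis (\<theta> + u)"
    by (simp only: step cis_mult mult.assoc)
  finally show ?case
    by (simp add: u_def algebra_simps)
qed

theorem theorem6:
  fixes x :: "nat \<Rightarrow> 'a::complex_normed_vector" and c :: 'a and n :: nat and R :: real
  assumes "n \<ge> 1"
    and "R > 0"
    and "\<And>k. k \<in> {1..n} \<Longrightarrow> norm (x k - c) \<le> R"
  shows "\<forall>m\<in>{1..n}. \<forall>\<omega>::real. (\<forall>l::int. \<omega> \<noteq> of_int l / of_nat m * pi) \<longrightarrow>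
    norm (dft \<omega> n x m
        - (complex_of_real (sin (\<omega> * of_nat m * of_nat n) / sin (\<omega> * of_nat m))
            * exp (complex_of_real \<omega> * (of_nat n + 1) * \<i> * of_nat m))
          *\<^sub>C ((1 / of_nat n) *\<^sub>C (\<Sum>k=1..n. x k)))
    \<le> R * (\<Sum>k=1..n. cmod (exp (2 * complex_of_real \<omega> * \<i> * of_nat m * of_nat k)
        - 1 / of_nat n
          * complex_of_real (sin (\<omega> * of_nat m * of_nat n) / sin (\<omega> * of_nat m))
          * exp (complex_of_real \<omega> * (of_nat n + 1) * \<i> * of_nat m)))"
proof (intro ballI allI impI)
  fix m and \<omega> :: real
  assume m: "m \<in> {1..n}" and \<omega>: "\<forall>l::int. \<omega> \<noteq> of_int l / of_nat m * pi"
  define \<theta> where "\<theta> = \<omega> * of_nat m"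
  \<comment> \<open>The excluded frequencies are the zeros of \<open>sin (\<omega> * m)\<close>;
    solving for \<open>\<omega>\<close> uses \<open>m \<ge> 1\<close>.\<close>
  have "sin \<theta> \<noteq> 0"
  proof
    assume "sin \<theta> = 0"
    then obtain l :: int where "\<theta> = of_int l * pi"
      by (auto simp: sin_zero_iff_int2)
    then have "\<omega> = of_int l / of_nat m * pi"
      using m by (simp add: \<theta>_def field_simps)
    with \<omega> show False by blast
  qed
  have weight: "exp (2 * complex_of_real \<omega> * \<i> * of_nat m * of_nat k) = cis (2 * \<theta> * of_nat k)" for k
    by (simp add: cis_conv_exp \<theta>_def mult_ac)
  have phase: "exp (complex_of_real \<omega> * (of_nat n + 1) * \<i> * of_nat m) = cis (\<theta> * (of_nat n + 1))"
    by (simp add: cis_conv_exp \<theta>_def mult_ac)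
  have A: "(\<Sum>k=1..n. cis (2 * \<theta> * of_nat k))
      = complex_of_real (sin (\<theta> * of_nat n) / sin \<theta>) * cis (\<theta> * (of_nat n + 1))"
    using sin_mult_sum_cis[of \<theta> n] \<open>sin \<theta> \<noteq> 0\<close> by (simp add: field_simps)
  show "norm (dft \<omega> n x m
        - (complex_of_real (sin (\<omega> * of_nat m * of_nat n) / sin (\<omega> * of_nat m))
            * exp (complex_of_real \<omega> * (of_nat n + 1) * \<i> * of_nat m))
          *\<^sub>C ((1 / of_nat n) *\<^sub>C (\<Sum>k=1..n. x k)))
    \<le> R * (\<Sum>k=1..n. cmod (exp (2 * complex_of_real \<omega> * \<i> * of_nat m * of_nat k)
        - 1 / of_nat n
          * complex_of_real (sin (\<omega> * of_nat m * of_nat n) / sin (\<omega> * of_nat m))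
          * exp (complex_of_real \<omega> * (of_nat n + 1) * \<i> * of_nat m)))"
    using norm_weighted_sum_diff_mean_le[of "{1..n}" x c R "\<lambda>k. cis (2 * \<theta> * of_nat k)"] assms
    \<comment> \<open>The rewriting also reaches the chained instance of the general bound: there
      \<open>A\<close> replaces the sum of the weights by its closed form, while
      \<open>weight\<close> and \<open>phase\<close> bring the goal to \<open>cis\<close>
      form.\<close>
    unfolding dft_def weight phase \<theta>_def[symmetric] A
    by (simp add: mult.assoc)
qed

end
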